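(* Let $X$ be a quasi-metric space and let $\delta\geq 0$. Then $X$ is $\delta$-$\mathrm{Sym}$-coarsely injective if and only if $X$ (identified with its image $\mathfrak q(X)$ under the canonical embedding $\mathfrak q\colon X\to Q(X)$) is $\delta$-$\mathrm{Sym}$-large in its $q$-hyperconvex hull $Q(X)$.
   Context: A quasi-metric space is a set $X$ with a map $d\colon X\times X\to[0,\infty)$ such that $d(x,y)\leq d(x,z)+d(z,y)$ for all $x,y,z\in X$, and, for all $x,y\in X$, $d(x,y)=d(y,x)=0$ if and only if $x=y$ (symmetry is not required). Let $d^{-1}(x,y)=d(y,x)$, $d^s(x,y)=\max\{d(x,y),d(y,x)\}$, and $C_d(x,r)=\{y\in X\mid d(x,y)\leq r\}$. $(X,d)$ is $\delta$-$\mathrm{Sym}$-coarsely injective if, for every family $\{(x_i,r_i,s_i)\}_{i\in I}\subseteq X\times[0,\infty)\times[0,\infty)$ satisfying $d(x_i,x_j)\leq r_i+s_j$ for all $i,j\in I$, one has $\bigcap_{i\in I}\big(C_d(x_i,r_i+\delta)\cap C_{d^{-1}}(x_i,s_i+\delta)\big)\neq\emptyset$ (where the intersection over the empty family is $X$). A subset $A$ of a quasi-metric space $(Z,d)$ is $\delta$-$\mathrm{Sym}$-large in $Z$ if for every $z\in Z$ there is $a\in A$ with $d^s(z,a)\leq\delta$. $q$-hyperconvex hull: let $P(X)$ be the set of pairs $f=(f_1,f_2)$ of maps $f_i\colon X\to[0,\infty)$ such that $d(x,y)\leq f_2(x)+f_1(y)$ for all $x,y\in X$, partially ordered by $(f_1,f_2)\leq(g_1,g_2)$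 iff $f_1\leq g_1$ and $f_2\leq g_2$ pointwise. $Q(X)\subseteq P(X)$ is the set of minimal elements, endowed with $$D(f,g)=\max\Big\{\sup_{x\in X}\max\{f_1(x)-g_1(x),0\},\ \sup_{x\in X}\max\{g_2(x)-f_2(x),0\}\Big\},$$ which is known to be a (finite-valued) quasi-metric on $Q(X)$. The canonical isometric embedding $\mathfrak q\colon X\to Q(X)$ is $\mathfrak q(x)=(d(x,\cdot),d(\cdot,x))$. *)

theory Defs
  imports Complex_Main "HOL-Library.FuncSet"
begin

locale quasi_metric_space =
  fixes X :: "'a set" and d :: "'a \<Rightarrow> 'a \<Rightarrow> real"
  assumes nonneg: "\<lbrakk>x \<in> X; y \<in> X\<rbrakk> \<Longrightarrow> 0 \<le> d x y"
    and triangle: "\<lbrakk>x \<in> X; y \<in> X; z \<in> X\<rbrakk> \<Longrightarrow> d x y \<le> d x z + d z y"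
    and separation: "\<lbrakk>x \<in> X; y \<in> X\<rbrakk> \<Longrightarrow> (d x y = 0 \<and> d y x = 0) \<longleftrightarrow> x = y"

definition conjugate :: "('a \<Rightarrow> 'a \<Rightarrow> real) \<Rightarrow> 'a \<Rightarrow> 'a \<Rightarrow> real" where
  "conjugate d x y = d y x"

definition symmetrization :: "('a \<Rightarrow> 'a \<Rightarrow> real) \<Rightarrow> 'a \<Rightarrow> 'a \<Rightarrow> real" where
  "symmetrization d x y = max (d x y) (d y x)"

definition closed_ball :: "'a set \<Rightarrow> ('a \<Rightarrow> 'a \<Rightarrow> real) \<Rightarrow> 'a \<Rightarrow> real \<Rightarrow> 'a set" where
  "closed_ball X d x r = {y \<in> X. d x y \<le> r}"

text \<open>A family of triples enters only through its range, so families are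
  represented by sets of triples; \<open>sym_coarsely_injective_family\<close> below recovers
  families over an arbitrary index type. The outer intersection with \<open>X\<close> makes the
  intersection over the empty family equal to \<open>X\<close>.\<close>

definition sym_coarsely_injective :: "real \<Rightarrow> 'a set \<Rightarrow> ('a \<Rightarrow> 'a \<Rightarrow> real) \<Rightarrow> bool" where
  "sym_coarsely_injective \<delta> X d \<longleftrightarrow>
    (\<forall>F \<subseteq> X \<times> {0..} \<times> {0..}.
      (\<forall>(x, r, s) \<in> F. \<forall>(x', r', s') \<in> F. d x x' \<le> r + s') \<longrightarrow>
      X \<inter> (\<Inter>(x, r, s) \<in> F.
        closed_ball X d x (r + \<delta>) \<inter> closed_ball X (conjugate d) x (s + \<delta>)) \<noteq> {})"

lemma sym_coarsely_injective_family:
  assumes "sym_coarsely_injective \<delta> X d"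
    and "\<And>i. i \<in> I \<Longrightarrow> x i \<in> X \<and> 0 \<le> r i \<and> 0 \<le> s i"
    and "\<And>i j. \<lbrakk>i \<in> I; j \<in> I\<rbrakk> \<Longrightarrow> d (x i) (x j) \<le> r i + s j"
  shows "X \<inter> (\<Inter>i \<in> I.
    closed_ball X d (x i) (r i + \<delta>) \<inter> closed_ball X (conjugate d) (x i) (s i + \<delta>)) \<noteq> {}"
proof -
  let ?F = "(\<lambda>i. (x i, r i, s i)) ` I"
  have "?F \<subseteq> X \<times> {0..} \<times> {0..}"
    and "\<forall>(x, r, s) \<in> ?F. \<forall>(x', r', s') \<in> ?F. d x x' \<le> r + s'"
    using assms(2,3) by auto
  with assms(1) have "X \<inter> (\<Inter>(x, r, s) \<in> ?F.
      closed_ball X d x (r + \<delta>) \<inter> closed_ball X (conjugate d) x (s + \<delta>)) \<noteq> {}"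
    unfolding sym_coarsely_injective_def by blast
  then show ?thesis by simp
qed

definition sym_large :: "real \<Rightarrow> 'a set \<Rightarrow> 'a set \<Rightarrow> ('a \<Rightarrow> 'a \<Rightarrow> real) \<Rightarrow> bool" where
  "sym_large \<delta> A Z d \<longleftrightarrow> A \<subseteq> Z \<and> (\<forall>z \<in> Z. \<exists>a \<in> A. symmetrization d z a \<le> \<delta>)"

text \<open>Maps on \<open>X\<close> are extensional functions, so that equality of pairs means agreement on \<open>X\<close>.\<close>

type_synonym 'a function_pair = "('a \<Rightarrow> real) \<times> ('a \<Rightarrow> real)"

definition ample_pairs :: "'a set \<Rightarrow> ('a \<Rightarrow> 'a \<Rightarrow> real) \<Rightarrow> 'a function_pair set" where
  "ample_pairs X d = {(f1, f2). f1 \<in> X \<rightarrow>\<^sub>E {0..} \<and> f2 \<in> X \<rightarrow>\<^sub>E {0..} \<and>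
    (\<forall>x \<in> X. \<forall>y \<in> X. d x y \<le> f2 x + f1 y)}"

definition pair_le :: "'a set \<Rightarrow> 'a function_pair \<Rightarrow> 'a function_pair \<Rightarrow> bool" where
  "pair_le X f g \<longleftrightarrow> (\<forall>x \<in> X. fst f x \<le> fst g x) \<and> (\<forall>x \<in> X. snd f x \<le> snd g x)"

definition q_hull :: "'a set \<Rightarrow> ('a \<Rightarrow> 'a \<Rightarrow> real) \<Rightarrow> 'a function_pair set" where
  "q_hull X d = {f \<in> ample_pairs X d. \<forall>g \<in> ample_pairs X d. pair_le X g f \<longrightarrow> g = f}"

text \<open>The suprema are taken in \<open>[0, \<infinity>)\<close>: inserting \<open>0\<close> changes nothing for nonempty \<open>X\<close>
  and gives the value \<open>0\<close> for empty \<open>X\<close>. They are finite for pairs in the hull.\<close>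

definition hull_dist :: "'a set \<Rightarrow> 'a function_pair \<Rightarrow> 'a function_pair \<Rightarrow> real" where
  "hull_dist X f g = max
    (Sup (insert 0 ((\<lambda>x. max (fst f x - fst g x) 0) ` X)))
    (Sup (insert 0 ((\<lambda>x. max (snd g x - snd f x) 0) ` X)))"

definition canonical_embedding ::
  "'a set \<Rightarrow> ('a \<Rightarrow> 'a \<Rightarrow> real) \<Rightarrow> 'a \<Rightarrow> 'a function_pair" where
  "canonical_embedding X d x = (restrict (\<lambda>y. d x y) X, restrict (\<lambda>y. d y x) X)"

end

theory Submission
  imports Defs
begin

text \<open>
  The two properties are translations of each other, because a compatible family of triples
  \<open>(x, r, s)\<close> and an ample pair are nearly the same object: an ample pair \<open>f\<close> is the
  compatible family of all \<open>(x, f\<^sub>2 x, f\<^sub>1 x)\<close>, and a point \<open>z\<close> lies in the intersection of the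
  \<open>\<delta>\<close>-enlarged balls of that family exactly when \<open>d z x \<le> f\<^sub>1 x + \<delta>\<close> and \<open>d x z \<le> f\<^sub>2 x + \<delta>\<close>
  for all \<open>x\<close>. These are two of the four inequalities expressing that the symmetrized hull
  distance from \<open>f\<close> to the embedded point \<open>z\<close> is at most \<open>\<delta>\<close>.

  If \<open>X\<close> is coarsely injective and \<open>f\<close> is minimal, such a \<open>z\<close> exists, and the other two
  inequalities, \<open>f\<^sub>1 x \<le> d z x + \<delta>\<close> and \<open>f\<^sub>2 x \<le> d x z + \<delta>\<close>, come from minimality: a value of a
  minimal pair cannot exceed a nonnegative number by which it could be replaced
  (lemmas \<open>q_hull_fst_le\<close> and \<open>q_hull_snd_le\<close>).

  Conversely, an arbitrary compatible family is extended to an ample pair by taking infima of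
  \<open>s + d x y\<close> and \<open>r + d y x\<close> over the family; this pair lies below the prescribed radii because
  \<open>d x x = 0\<close>. By Zorn's lemma there is a minimal pair below it (\<open>q_hull_below\<close>), and a point
  of \<open>X\<close> that is \<open>\<delta>\<close>-close to the minimal pair lies in all the enlarged balls.
\<close>

section \<open>Pointwise infima of ample pairs\<close>

text \<open>
  Ampleness of a pointwise infimum needs the defining inequality across different members,
  since the two infima are approached along different indices. This serves both for chains
  of ample pairs and for the pair generated by a compatible family of triples.
\<close>

lemma INF_pair_ample:
  fixes d :: "'a \<Rightarrow> 'a \<Rightarrow> real" and u v :: "'i \<Rightarrow> 'a \<Rightarrow> real"
  assumes "I \<noteq> {}"
    and u: "\<And>i x. \<lbrakk>i \<in> I; x \<in> X\<rbrakk> \<Longrightarrow> 0 \<le> u i x"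
    and v: "\<And>i x. \<lbrakk>i \<in> I; x \<in> X\<rbrakk> \<Longrightarrow> 0 \<le> v i x"
    and cross: "\<And>i j x y. \<lbrakk>i \<in> I; j \<in> I; x \<in> X; y \<in> X\<rbrakk> \<Longrightarrow> d x y \<le> v i x + u j y"
  shows "(\<lambda>x\<in>X. INF i\<in>I. u i x, \<lambda>x\<in>X. INF i\<in>I. v i x) \<in> ample_pairs X d"
proof -
  have "0 \<le> (INF i\<in>I. u i x)" "0 \<le> (INF i\<in>I. v i x)" if "x \<in> X" for x
    using that u v \<open>I \<noteq> {}\<close> by (auto intro!: cINF_greatest)
  moreover have "d x y \<le> (INF i\<in>I. v i x) + (INF j\<in>I. u j y)" if "x \<in> X" "y \<in> X" for x y
  proof -
    have "d x y - u j y \<le> (INF i\<in>I. v i x)" if "j \<in> I" for j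
    proof (rule cINF_greatest[OF \<open>I \<noteq> {}\<close>])
      show "d x y - u j y \<le> v i x" if "i \<in> I" for i
        using cross[OF that \<open>j \<in> I\<close> \<open>x \<in> X\<close> \<open>y \<in> X\<close>] by simp
    qed
    then have "d x y - (INF i\<in>I. v i x) \<le> (INF j\<in>I. u j y)"
      by (intro cINF_greatest[OF \<open>I \<noteq> {}\<close>]) (simp add: algebra_simps)
    then show ?thesis by simp
  qed
  ultimately show ?thesis by (auto simp: ample_pairs_def)
qed

lemma INF_pair_le:
  fixes u v :: "'i \<Rightarrow> 'a \<Rightarrow> real"
  assumes "i \<in> I" "x \<in> X"
    and "\<And>i x. \<lbrakk>i \<in> I; x \<in> X\<rbrakk> \<Longrightarrow> 0 \<le> u i x"
  shows "(INF i\<in>I. u i x) \<le> u i x"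
  using assms by (intro cINF_lower bdd_belowI[where m = 0]) auto

section \<open>Minimal pairs\<close>

lemma ample_pairsD:
  assumes "f \<in> ample_pairs X d"
  shows "\<And>x. x \<in> X \<Longrightarrow> 0 \<le> fst f x" "\<And>x. x \<in> X \<Longrightarrow> 0 \<le> snd f x"
    and "\<And>x y. \<lbrakk>x \<in> X; y \<in> X\<rbrakk> \<Longrightarrow> d x y \<le> snd f x + fst f y"
  using assms by (auto simp: ample_pairs_def PiE_iff)

lemma ample_pairs_antisym:
  assumes "f \<in> ample_pairs X d" "g \<in> ample_pairs X d" "pair_le X f g" "pair_le X g f"
  shows "f = g"
proof (rule prod_eqI)
  have f: "fst f \<in> extensional X" "snd f \<in> extensional X"
    and g: "fst g \<in> extensional X" "snd g \<in> extensional X"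
    using assms(1,2) by (auto simp: ample_pairs_def PiE_def)
  show "fst f = fst g"
    using f g assms(3,4) by (intro extensionalityI[of _ X]) (auto simp: pair_le_def intro: antisym)
  show "snd f = snd g"
    using f g assms(3,4) by (intro extensionalityI[of _ X]) (auto simp: pair_le_def intro: antisym)
qed

text \<open>
  Zorn's lemma for the reversed order. A nonempty chain is bounded below by its pointwise
  infimum, which is ample because two members of the chain are comparable: the cross
  inequality follows from ampleness of the smaller one.
\<close>

lemma q_hull_below:
  assumes h: "h \<in> ample_pairs X d"
  obtains f where "f \<in> q_hull X d" "pair_le X f h"
proof -
  define A where "A = {g \<in> ample_pairs X d. pair_le X g h}"
  let ?ge = "\<lambda>f g. pair_le X g f"
  have hA: "h \<in> A" using h by (simp add: A_def pair_le_def)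
  have trans: "pair_le X f k" if "pair_le X f g" "pair_le X g k" for f g k
    using that by (force simp: pair_le_def)
  have "\<exists>m\<in>A. \<forall>a\<in>A. ?ge m a \<longrightarrow> a = m"
  proof (rule predicate_Zorn)
    show "partial_order_on A (relation_of ?ge A)"
    proof (rule partial_order_on_relation_ofI)
      show "?ge a a" for a by (simp add: pair_le_def)
      show "?ge a c" if "?ge a b" "?ge b c" for a b c using that trans by blast
      show "a = b" if "a \<in> A" "b \<in> A" "?ge a b" "?ge b a" for a b
        using that ample_pairs_antisym[of a X d b] by (simp add: A_def)
    qed
    fix C assume C: "C \<in> Chains (relation_of ?ge A)"
    have CA: "C \<subseteq> A" using C by (auto simp: Chains_def relation_of_def)
    have comparable: "pair_le X f g \<or> pair_le X g f" if "f \<in> C" "g \<in> C" for f g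
      using C that by (auto simp: Chains_def relation_of_def)
    show "\<exists>u\<in>A. \<forall>a\<in>C. ?ge a u"
    proof (cases "C = {}")
      case True
      then show ?thesis using hA by blast
    next
      case False
      let ?u = "(\<lambda>x\<in>X. INF g\<in>C. fst g x, \<lambda>x\<in>X. INF g\<in>C. snd g x)"
      have ample: "g \<in> ample_pairs X d" if "g \<in> C" for g using that CA by (auto simp: A_def)
      note nn = ample_pairsD(1,2)[OF ample]
      have "?u \<in> ample_pairs X d"
      proof (rule INF_pair_ample[OF False nn])
        fix f g x y assume fg: "f \<in> C" "g \<in> C" and xy: "x \<in> X" "y \<in> X"
        show "d x y \<le> snd f x + fst g y"
          using comparable[OF fg] ample_pairsD(3)[OF ample[OF fg(1)] xy]
            ample_pairsD(3)[OF ample[OF fg(2)] xy] xy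
          by (fastforce simp: pair_le_def)
      qed auto
      moreover have lower: "pair_le X ?u g" if "g \<in> C" for g
        using INF_pair_le[of g C _ X fst] INF_pair_le[of g C _ X snd] that nn
        by (auto simp: pair_le_def)
      moreover obtain g where "g \<in> C" using False by blast
      then have "pair_le X ?u h" using trans[OF lower, of g h] CA by (auto simp: A_def)
      ultimately show ?thesis unfolding A_def by blast
    qed
  qed
  then obtain f where f: "f \<in> A" "\<And>g. \<lbrakk>g \<in> A; pair_le X g f\<rbrakk> \<Longrightarrow> g = f" by blast
  \<comment> \<open>Everything below \<open>f\<close> is below \<open>h\<close>, so minimality in \<open>A\<close> is minimality among all ample pairs.\<close>
  then have "f \<in> q_hull X d" using trans by (auto simp: A_def q_hull_def)
  with f(1) show thesis by (intro that) (auto simp: A_def)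
qed

text \<open>
  Otherwise the single value at \<open>x\<close> could be lowered to \<open>b\<close> without losing ampleness,
  contradicting minimality.
\<close>

lemma q_hull_fst_le:
  assumes f: "f \<in> q_hull X d" and "x \<in> X" "0 \<le> b"
    and b: "\<And>y. y \<in> X \<Longrightarrow> d y x \<le> snd f y + b"
  shows "fst f x \<le> b"
proof (rule ccontr)
  assume less: "\<not> fst f x \<le> b"
  let ?g = "((fst f)(x := b), snd f)"
  have "?g \<in> ample_pairs X d" "pair_le X ?g f"
    using f \<open>x \<in> X\<close> \<open>0 \<le> b\<close> b less
    by (auto simp: q_hull_def ample_pairs_def pair_le_def PiE_iff extensional_def)
  then have "?g = f" using f by (auto simp: q_hull_def)
  then have "fst f x = b" by (metis fst_conv fun_upd_same)
  with less show False by simp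
qed

lemma q_hull_snd_le:
  assumes f: "f \<in> q_hull X d" and "x \<in> X" "0 \<le> b"
    and b: "\<And>y. y \<in> X \<Longrightarrow> d x y \<le> b + fst f y"
  shows "snd f x \<le> b"
proof (rule ccontr)
  assume less: "\<not> snd f x \<le> b"
  let ?g = "(fst f, (snd f)(x := b))"
  have "?g \<in> ample_pairs X d" "pair_le X ?g f"
    using f \<open>x \<in> X\<close> \<open>0 \<le> b\<close> b less
    by (auto simp: q_hull_def ample_pairs_def pair_le_def PiE_iff extensional_def)
  then have "?g = f" using f by (auto simp: q_hull_def)
  then have "snd f x = b" by (metis snd_conv fun_upd_same)
  with less show False by simp
qed

text \<open>
  An ample pair below the image of \<open>x\<close> vanishes at \<open>x\<close>; ampleness applied to \<open>x\<close> and a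
  second point then forces it back up to the distance functions of \<open>x\<close>.
\<close>

lemma (in quasi_metric_space) canonical_embedding_in_q_hull:
  assumes x: "x \<in> X"
  shows "canonical_embedding X d x \<in> q_hull X d"
proof -
  let ?q = "canonical_embedding X d x"
  have xx: "d x x = 0" using separation[OF x x] by simp
  have q: "?q \<in> ample_pairs X d"
    using x nonneg triangle by (auto simp: ample_pairs_def canonical_embedding_def)
  have "g = ?q" if g: "g \<in> ample_pairs X d" and le: "pair_le X g ?q" for g
  proof (rule ample_pairs_antisym[OF g q le])
    have "fst g x = 0" "snd g x = 0"
      using le ample_pairsD(1,2)[OF g x] x xx
      by (auto simp: pair_le_def canonical_embedding_def intro: antisym)
    then show "pair_le X ?q g"
      using ample_pairsD(3)[OF g x] ample_pairsD(3)[OF g _ x] x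
      by (auto simp: pair_le_def canonical_embedding_def)
  qed
  with q show ?thesis by (simp add: q_hull_def)
qed

section \<open>Distance from a pair to an embedded point\<close>

lemma Sup_insert_zero_le_iff:
  fixes u :: "'a \<Rightarrow> real"
  assumes "0 \<le> c" and "bdd_above (u ` X)"
  shows "Sup (insert 0 ((\<lambda>x. max (u x) 0) ` X)) \<le> c \<longleftrightarrow> (\<forall>x\<in>X. u x \<le> c)"
proof -
  obtain B where "\<And>x. x \<in> X \<Longrightarrow> u x \<le> B" using assms(2) by (auto simp: bdd_above_def)
  then have "bdd_above (insert 0 ((\<lambda>x. max (u x) 0) ` X))"
    by (intro bdd_aboveI[where M = "max B 0"]) (auto simp: le_max_iff_disj)
  then show ?thesis using assms(1) by (subst cSup_le_iff) auto
qed

text \<open>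
  Two of the four differences are bounded by ampleness. The other two need the Lipschitz
  property of minimal pairs, \<open>f\<^sub>1 x \<le> f\<^sub>1 z + d z x\<close> and \<open>f\<^sub>2 x \<le> f\<^sub>2 z + d x z\<close>; without
  boundedness the real suprema would carry no information.
\<close>

lemma (in quasi_metric_space) symmetrization_hull_dist_le_iff:
  assumes f: "f \<in> q_hull X d" and z: "z \<in> X" and "0 \<le> \<delta>"
  shows "symmetrization (hull_dist X) f (canonical_embedding X d z) \<le> \<delta> \<longleftrightarrow>
    (\<forall>x\<in>X. d z x \<le> fst f x + \<delta> \<and> d x z \<le> snd f x + \<delta>
      \<and> fst f x \<le> d z x + \<delta> \<and> snd f x \<le> d x z + \<delta>)"
proof -
  have fa: "f \<in> ample_pairs X d" using f by (simp add: q_hull_def)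
  note D = ample_pairsD[OF fa]
  let ?q = "canonical_embedding X d z"
  have q: "fst ?q x = d z x" "snd ?q x = d x z" if "x \<in> X" for x
    using that by (simp_all add: canonical_embedding_def)
  have lip1: "fst f x \<le> fst f z + d z x" if x: "x \<in> X" for x
  proof (rule q_hull_fst_le[OF f x])
    show "0 \<le> fst f z + d z x" using D(1)[OF z] nonneg[OF z x] by simp
    show "d y x \<le> snd f y + (fst f z + d z x)" if "y \<in> X" for y
      using triangle[OF that x z] D(3)[OF that z] by simp
  qed
  have lip2: "snd f x \<le> snd f z + d x z" if x: "x \<in> X" for x
  proof (rule q_hull_snd_le[OF f x])
    show "0 \<le> snd f z + d x z" using D(2)[OF z] nonneg[OF x z] by simp
    show "d x y \<le> snd f z + d x z + fst f y" if "y \<in> X" for y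
      using triangle[OF x that z] D(3)[OF z that] by simp
  qed
  have bdd: "bdd_above ((\<lambda>x. fst f x - fst ?q x) ` X)" "bdd_above ((\<lambda>x. snd ?q x - snd f x) ` X)"
    "bdd_above ((\<lambda>x. fst ?q x - fst f x) ` X)" "bdd_above ((\<lambda>x. snd f x - snd ?q x) ` X)"
    using lip1 lip2 D(3)[OF _ z] D(3)[OF z] q
    by (auto intro: bdd_aboveI2[where M = "fst f z"] bdd_aboveI2[where M = "snd f z"]
        simp: algebra_simps)
  show ?thesis
    unfolding symmetrization_def hull_dist_def max.bounded_iff
      bdd[THEN Sup_insert_zero_le_iff[OF \<open>0 \<le> \<delta>\<close>]]
    using q by (auto simp: algebra_simps)
qed

section \<open>Coarse injectivity and largeness in the hull\<close>

theorem theorem4p9: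
  fixes X :: "'a set" and d :: "'a \<Rightarrow> 'a \<Rightarrow> real" and \<delta> :: real
  assumes "quasi_metric_space X d"
    and "\<delta> \<ge> 0"
  shows "sym_coarsely_injective \<delta> X d \<longleftrightarrow>
    sym_large \<delta> (canonical_embedding X d ` X) (q_hull X d) (hull_dist X)"
proof
  interpret quasi_metric_space X d by fact
  assume inj: "sym_coarsely_injective \<delta> X d"
  have "\<exists>a \<in> canonical_embedding X d ` X. symmetrization (hull_dist X) f a \<le> \<delta>"
    if f: "f \<in> q_hull X d" for f
  proof -
    have fa: "f \<in> ample_pairs X d" using f by (simp add: q_hull_def)
    have "X \<inter> (\<Inter>x\<in>X. closed_ball X d x (snd f x + \<delta>) \<inter>
        closed_ball X (conjugate d) x (fst f x + \<delta>)) \<noteq> {}"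
      using ample_pairsD[OF fa] by (intro sym_coarsely_injective_family[OF inj]) auto
    then obtain z where z: "z \<in> X" and up: "\<And>x. x \<in> X \<Longrightarrow> d x z \<le> snd f x + \<delta>"
        "\<And>x. x \<in> X \<Longrightarrow> d z x \<le> fst f x + \<delta>"
      by (auto simp: closed_ball_def conjugate_def)
    have "fst f x \<le> d z x + \<delta>" if x: "x \<in> X" for x
    proof (rule q_hull_fst_le[OF f x])
      show "0 \<le> d z x + \<delta>" using nonneg[OF z x] \<open>\<delta> \<ge> 0\<close> by simp
      show "d y x \<le> snd f y + (d z x + \<delta>)" if "y \<in> X" for y
        using triangle[OF that x z] up(1)[OF that] by simp
    qed
    moreover have "snd f x \<le> d x z + \<delta>" if x: "x \<in> X" for x
    proof (rule q_hull_snd_le[OF f x])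
      show "0 \<le> d x z + \<delta>" using nonneg[OF x z] \<open>\<delta> \<ge> 0\<close> by simp
      show "d x y \<le> d x z + \<delta> + fst f y" if "y \<in> X" for y
        using triangle[OF x that z] up(2)[OF that] by simp
    qed
    ultimately have "symmetrization (hull_dist X) f (canonical_embedding X d z) \<le> \<delta>"
      using up symmetrization_hull_dist_le_iff[OF f z \<open>\<delta> \<ge> 0\<close>] by blast
    with z show ?thesis by blast
  qed
  then show "sym_large \<delta> (canonical_embedding X d ` X) (q_hull X d) (hull_dist X)"
    using canonical_embedding_in_q_hull by (auto simp: sym_large_def)
next
  interpret quasi_metric_space X d by fact
  assume large: "sym_large \<delta> (canonical_embedding X d ` X) (q_hull X d) (hull_dist X)"
  have near: "\<exists>z\<in>X. \<forall>x\<in>X. d z x \<le> fst h x + \<delta> \<and> d x z \<le> snd h x + \<delta>"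
    if h: "h \<in> ample_pairs X d" for h
  proof -
    obtain f where f: "f \<in> q_hull X d" and le: "pair_le X f h" using q_hull_below[OF h] .
    obtain z where z: "z \<in> X"
      and "symmetrization (hull_dist X) f (canonical_embedding X d z) \<le> \<delta>"
      using large f by (auto simp: sym_large_def)
    then have "\<forall>x\<in>X. d z x \<le> fst f x + \<delta> \<and> d x z \<le> snd f x + \<delta>"
      using symmetrization_hull_dist_le_iff[OF f z \<open>\<delta> \<ge> 0\<close>] by blast
    with le z show ?thesis by (force simp: pair_le_def)
  qed
  \<comment> \<open>This settles the empty family. The hull of the empty set is a single pair,
      while the image of the embedding would be empty.\<close>
  have "X \<noteq> {}"
  proof
    assume "X = {}"
    then have "(\<lambda>_. undefined, \<lambda>_. undefined) \<in> ample_pairs X d" by (simp add: ample_pairs_def)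
    from near[OF this] \<open>X = {}\<close> show False by simp
  qed
  show "sym_coarsely_injective \<delta> X d"
    unfolding sym_coarsely_injective_def
  proof (intro allI impI)
    fix F assume F: "F \<subseteq> X \<times> {0..} \<times> {0..}"
      and compat: "\<forall>(x, r, s) \<in> F. \<forall>(x', r', s') \<in> F. d x x' \<le> r + s'"
    let ?balls = "\<Inter>(x, r, s) \<in> F.
        closed_ball X d x (r + \<delta>) \<inter> closed_ball X (conjugate d) x (s + \<delta>)"
    show "X \<inter> ?balls \<noteq> {}"
    proof (cases "F = {}")
      case True
      with \<open>X \<noteq> {}\<close> show ?thesis by simp
    next
      case False
      define u where "u = (\<lambda>(x, r :: real, s) y. s + d x y)"
      define v where "v = (\<lambda>(x, r, s :: real) y. r + d y x)"
      have u0: "0 \<le> u i y" and v0: "0 \<le> v i y" if "i \<in> F" "y \<in> X" for i y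
        using that F nonneg by (auto simp: u_def v_def)
      let ?h = "(\<lambda>y\<in>X. INF i\<in>F. u i y, \<lambda>y\<in>X. INF i\<in>F. v i y)"
      have "?h \<in> ample_pairs X d"
      proof (rule INF_pair_ample[OF False u0 v0])
        fix i j y y' assume ij: "i \<in> F" "j \<in> F" and y: "y \<in> X" "y' \<in> X"
        obtain x r s x' r' s' where eq: "i = (x, r, s)" "j = (x', r', s')"
          by (metis prod_cases3)
        have x: "x \<in> X" "x' \<in> X" and rs: "d x x' \<le> r + s'"
          using F compat ij eq by auto
        have "d y y' \<le> d y x + (d x x' + d x' y')"
          using triangle[OF y x(1)] triangle[OF x(1) y(2) x(2)] by simp
        also have "\<dots> \<le> v i y + u j y'" using rs by (simp add: eq u_def v_def)
        finally show "d y y' \<le> v i y + u j y'" .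
      qed
      from near[OF this] obtain z where z: "z \<in> X"
        and zu: "\<And>x. x \<in> X \<Longrightarrow> d z x \<le> (INF i\<in>F. u i x) + \<delta>"
        and zv: "\<And>x. x \<in> X \<Longrightarrow> d x z \<le> (INF i\<in>F. v i x) + \<delta>"
        by auto
      have "d z x \<le> s + \<delta> \<and> d x z \<le> r + \<delta>" if i: "(x, r, s) \<in> F" for x r s
      proof -
        have x: "x \<in> X" using F i by auto
        then have xx: "d x x = 0" using separation by blast
        have "(INF i\<in>F. u i x) \<le> s" "(INF i\<in>F. v i x) \<le> r"
          using INF_pair_le[of _ F x X u, OF i x u0] INF_pair_le[of _ F x X v, OF i x v0] xx
          by (simp_all add: u_def v_def)
        then show ?thesis using zu[OF x] zv[OF x] by simp
      qed
      then have "z \<in> X \<inter> ?balls" using z by (auto simp: closed_ball_def conjugate_def)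
      then show ?thesis by blast
    qed
  qed
qed

end
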